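(* An ideal $I$ of $\mathbb{E}$ belongs to $\mathbf{J}_{\neg\neg}$ if, and only if, both of the following hold: (i) $I$ is an extended ideal, and therefore $u=u_{\mathrm{Ext}(I)}\in\mathbb{F}$ with $I\subseteq(u)$; and (ii) for any $v\in L$ satisfying $v\leq u$ there exists $w\leq v$ such that $w\in I$.
   Context: $\mathbb{E}$ is the monoid, under composition, of all strictly increasing (i.e. monotone and injective) maps $u:\mathbb{N}\to\mathbb{N}$. For an infinite $A\subseteq\mathbb{N}$, $u_A\in\mathbb{E}$ is the enumerating map of $A$, the unique element of $\mathbb{E}$ with image $A$. An ideal of $\mathbb{E}$ is a right ideal: a (possibly empty) subset $I\subseteq\mathbb{E}$ such that $u\in I$, $v\in\mathbb{E}$ imply $u\circ v\in I$; $(u)=\{u\circ v;v\in\mathbb{E}\}$ is the principal ideal generated by $u$. $\mathbb{E}$ is partially ordered by $w\leq v$ iff $w=v\circ h$ for some $h\in\mathbb{E}$ (equivalently $\mathrm{Im}(w)\subseteq\mathrm{Im}(v)$). $\mathbb{F}\subseteq\mathbb{E}$ is the submonoid of those $u\in\mathbb{E}$ with $\mathrm{Im}(u)$ cofinite in $\mathbb{N}$, and $L=\mathbb{E}\setminus\mathbb{F}$. The extent of an ideal $I$ is $\mathrm{Ext}(I)=\bigcup_{u\in I}\mathrm{Im}(u)$, and $I$ is called extended if $\mathrm{Ext}(I)$ is cofinite in $\mathbb{N}$. The double negation topology on $\mathbb{E}$ is $$\mathbf{J}_{\neg\neg}=\{I\text{ ideal of }\mathbb{E};\ \forall u\in\mathbb{E},\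 \exists v\in\mathbb{E},\ u\circ v\in I\}.$$ *)

theory Defs
  imports Main "HOL-Library.Infinite_Set"
begin

definition EE :: "(nat \<Rightarrow> nat) set" where
  "EE = {u. strict_mono u}"

definition FF :: "(nat \<Rightarrow> nat) set" where
  "FF = {u \<in> EE. finite (- range u)}"

definition LL :: "(nat \<Rightarrow> nat) set" where
  "LL = EE - FF"

text \<open>The enumerating map of an infinite set of naturals is the library function
  \<^const>\<open>enumerate\<close>; it is the unique element of \<^term>\<open>EE\<close> with the given image.\<close>

lemma strict_mono_range_le:
  fixes f g :: "nat \<Rightarrow> nat"
  assumes "strict_mono f" "strict_mono g" "range f \<subseteq> range g"
  shows "g n \<le> f n"
proof -
  have "\<forall>m. \<exists>k. f m = g k"
    using assms(3) by blast
  then obtain h where h: "\<And>m. f m = g (h m)"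
    by metis
  have "strict_mono h"
  proof (rule strict_monoI)
    fix a b :: nat
    assume "a < b"
    then have "g (h a) < g (h b)"
      using assms(1) by (simp add: strict_mono_less flip: h)
    then show "h a < h b"
      using assms(2) by (simp add: strict_mono_less)
  qed
  then have "n \<le> h n" by (rule strict_mono_imp_increasing)
  then show ?thesis using assms(2) by (simp add: h strict_mono_less_eq)
qed

lemma enumerate_unique_EE:
  fixes A :: "nat set"
  assumes "infinite A"
  shows "u \<in> EE \<and> range u = A \<longleftrightarrow> u = enumerate A"
proof -
  have e: "strict_mono (enumerate A)" "range (enumerate A) = A"
    using assms by (auto simp: strict_mono_enumerate range_enumerate)
  show ?thesis
  proof
    assume u: "u \<in> EE \<and> range u = A"
    then have "strict_mono u" by (simp add: EE_def)
    then have "u n = enumerate A n" for n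
      using u e strict_mono_range_le[of u "enumerate A" n] strict_mono_range_le[of "enumerate A" u n]
      by (intro order.antisym) blast+
    then show "u = enumerate A" by (rule ext)
  next
    assume "u = enumerate A"
    then show "u \<in> EE \<and> range u = A"
      using e by (simp only: EE_def mem_Collect_eq simp_thms)
  qed
qed

definition ideal_EE :: "(nat \<Rightarrow> nat) set \<Rightarrow> bool" where
  "ideal_EE I \<longleftrightarrow> I \<subseteq> EE \<and> (\<forall>u\<in>I. \<forall>v\<in>EE. u \<circ> v \<in> I)"

definition principal_EE :: "(nat \<Rightarrow> nat) \<Rightarrow> (nat \<Rightarrow> nat) set" where
  "principal_EE u = {u \<circ> v | v. v \<in> EE}"

definition le_EE :: "(nat \<Rightarrow> nat) \<Rightarrow> (nat \<Rightarrow> nat) \<Rightarrow> bool" where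
  "le_EE w v \<longleftrightarrow> (\<exists>h\<in>EE. w = v \<circ> h)"

definition Ext :: "(nat \<Rightarrow> nat) set \<Rightarrow> nat set" where
  "Ext I = (\<Union>u\<in>I. range u)"

definition extended :: "(nat \<Rightarrow> nat) set \<Rightarrow> bool" where
  "extended I \<longleftrightarrow> finite (- Ext I)"

definition J_notnot :: "(nat \<Rightarrow> nat) set set" where
  "J_notnot = {I. ideal_EE I \<and> (\<forall>u\<in>EE. \<exists>v\<in>EE. u \<circ> v \<in> I)}"

end

theory Submission
  imports Defs
begin

text \<open>The order on \<^const>\<open>EE\<close> is inclusion of images, so membership in the double negation
  topology says that below every \<open>u\<close> there is an element of \<open>I\<close>. If infinitely many numbers were
  outside \<^term>\<open>Ext I\<close>, then nothing in \<open>I\<close> could lie below their enumeration; this gives (i), and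
  (ii) is an instance of density. Conversely, (ii) only tests maps with co-infinite
  image inside \<^term>\<open>Ext I\<close>, but these lie below every \<open>u\<close>: by (i) the image of \<open>u\<close> meets
  \<^term>\<open>Ext I\<close> in an infinite set, and keeping every other point of this set
  gives the image of such a map.\<close>

lemma le_EE_iff_range_subset:
  assumes "w \<in> EE" "v \<in> EE"
  shows "le_EE w v \<longleftrightarrow> range w \<subseteq> range v"
proof
  assume "le_EE w v"
  then show "range w \<subseteq> range v"
    by (auto simp: le_EE_def)
next
  assume "range w \<subseteq> range v"
  then have "\<forall>m. \<exists>k. w m = v k"
    by blast
  then obtain h where h: "\<And>m. w m = v (h m)"
    by metis
  have "strict_mono h"
  proof (rule strict_monoI)
    fix a b :: nat
    assume "a < b"
    then have "v (h a) < v (h b)"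
      using assms(1) by (simp add: EE_def strict_mono_less flip: h)
    then show "h a < h b"
      using assms(2) by (simp add: EE_def strict_mono_less)
  qed
  moreover have "w = v \<circ> h"
    using h by auto
  ultimately show "le_EE w v"
    by (auto simp: le_EE_def EE_def)
qed

lemma enumerate_in_EE:
  fixes A :: "nat set"
  assumes "infinite A"
  shows "enumerate A \<in> EE"
  using enumerate_unique_EE[OF assms] by blast

lemma infinite_range_EE: "u \<in> EE \<Longrightarrow> infinite (range u)"
  using strict_mono_imp_inj_on[of u UNIV] by (auto simp: EE_def range_inj_infinite)

text \<open>Keep the points of \<open>A\<close> at even positions of its enumeration; the points at odd positions
  witness that the image is co-infinite, even when \<open>A\<close> itself is cofinite.\<close>

lemma exists_LL_range_subset:
  fixes A :: "nat set"
  assumes "infinite A"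
  shows "\<exists>v\<in>LL. range v \<subseteq> A"
proof -
  let ?e = "enumerate A"
  define v where "v = (\<lambda>n. ?e (2 * n))"
  have e: "strict_mono ?e"
    using assms by (rule strict_mono_enumerate)
  have "v \<in> EE"
    using e by (auto simp: EE_def v_def strict_mono_def)
  moreover have "v \<notin> FF"
  proof -
    have "inj (\<lambda>n. ?e (2 * n + 1))"
      using e by (auto simp: inj_def strict_mono_eq)
    then have "infinite (range (\<lambda>n. ?e (2 * n + 1)))"
      by (rule range_inj_infinite)
    moreover have "?e (2 * n + 1) \<noteq> ?e (2 * k)" for n k
      using e by (simp add: strict_mono_eq) presburger
    then have "range (\<lambda>n. ?e (2 * n + 1)) \<subseteq> - range v"
      by (auto simp: v_def)
    ultimately have "infinite (- range v)"
      using finite_subset by blast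
    then show ?thesis
      by (simp add: FF_def)
  qed
  moreover have "range v \<subseteq> A"
    using range_enumerate[OF assms] by (auto simp: v_def)
  ultimately show ?thesis
    by (auto simp: LL_def)
qed

lemma extended_enumerate_Ext:
  assumes "ideal_EE I" "extended I"
  shows "enumerate (Ext I) \<in> FF" "I \<subseteq> principal_EE (enumerate (Ext I))"
proof -
  have inf: "infinite (Ext I)"
    using assms(2) infinite_UNIV_nat by (auto simp: extended_def)
  then have u: "enumerate (Ext I) \<in> EE" "range (enumerate (Ext I)) = Ext I"
    by (simp_all add: enumerate_in_EE range_enumerate)
  then show "enumerate (Ext I) \<in> FF"
    using assms(2) by (simp add: FF_def extended_def)
  show "I \<subseteq> principal_EE (enumerate (Ext I))"
  proof
    fix w
    assume w: "w \<in> I"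
    then have "w \<in> EE" "range w \<subseteq> range (enumerate (Ext I))"
      using assms(1) u(2) by (auto simp: ideal_EE_def Ext_def)
    then have "le_EE w (enumerate (Ext I))"
      using le_EE_iff_range_subset u(1) by blast
    then show "w \<in> principal_EE (enumerate (Ext I))"
      by (auto simp: le_EE_def principal_EE_def)
  qed
qed

lemma J_notnot_extended:
  assumes "I \<in> J_notnot"
  shows "extended I"
proof (rule ccontr)
  assume "\<not> extended I"
  then have inf: "infinite (- Ext I)"
    by (simp add: extended_def)
  then obtain v where v: "enumerate (- Ext I) \<circ> v \<in> I"
    using assms enumerate_in_EE unfolding J_notnot_def by blast
  have "enumerate (- Ext I) (v 0) \<in> - Ext I"
    using inf by (rule enumerate_in_set)
  moreover have "range w \<subseteq> Ext I" if "w \<in> I" for w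
    using that by (auto simp: Ext_def)
  then have "enumerate (- Ext I) (v 0) \<in> Ext I"
    using v by fastforce
  ultimately show False
    by simp
qed

text \<open>Applying the hypothesis directly to \<open>u\<close> is impossible when \<open>u\<close> is in \<^const>\<open>FF\<close> or its
  image leaves \<^term>\<open>Ext I\<close>; it is applied to some \<open>v\<close> in \<^const>\<open>LL\<close> whose image lies in the
  infinite set \<^term>\<open>range u \<inter> Ext I\<close>, and an element of \<open>I\<close> below \<open>v\<close> is also below \<open>u\<close>.\<close>

lemma J_notnot_if_extended:
  assumes I: "ideal_EE I" and ext: "extended I"
    and below: "\<And>v. v \<in> LL \<Longrightarrow> le_EE v (enumerate (Ext I)) \<Longrightarrow> \<exists>w\<in>EE. le_EE w v \<and> w \<in> I"
  shows "I \<in> J_notnot"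
proof -
  have "\<exists>h\<in>EE. u \<circ> h \<in> I" if u: "u \<in> EE" for u
  proof -
    have "finite (range u - Ext I)"
      using ext by (auto simp: extended_def Diff_eq)
    then have "infinite (range u \<inter> Ext I)"
      using infinite_range_EE[OF u] by (metis Int_Diff_Un finite_Un)
    then obtain v where v: "v \<in> LL" "range v \<subseteq> range u \<inter> Ext I"
      using exists_LL_range_subset by blast
    have inf: "infinite (Ext I)"
      using ext infinite_UNIV_nat by (auto simp: extended_def)
    have vE: "v \<in> EE"
      using v(1) by (simp add: LL_def)
    then have "le_EE v (enumerate (Ext I))"
      using v(2) inf by (simp add: le_EE_iff_range_subset enumerate_in_EE range_enumerate)
    then obtain w where w: "w \<in> EE" "le_EE w v" "w \<in> I"
      using below v(1) by blast
    then have "range w \<subseteq> range u"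
      using v(2) vE by (auto simp: le_EE_iff_range_subset)
    then show ?thesis
      using w u le_EE_iff_range_subset[of w u] by (auto simp: le_EE_def)
  qed
  then show ?thesis
    using I by (simp add: J_notnot_def)
qed

theorem theorem3p6:
  fixes I :: "(nat \<Rightarrow> nat) set"
  assumes "ideal_EE I"
  shows "(extended I \<longrightarrow> enumerate (Ext I) \<in> FF \<and> I \<subseteq> principal_EE (enumerate (Ext I))) \<and>
    (I \<in> J_notnot \<longleftrightarrow>
      (extended I \<and> enumerate (Ext I) \<in> FF \<and> I \<subseteq> principal_EE (enumerate (Ext I))) \<and>
      (\<forall>v\<in>LL. le_EE v (enumerate (Ext I)) \<longrightarrow> (\<exists>w\<in>EE. le_EE w v \<and> w \<in> I)))"
proof -
  have "\<exists>w\<in>EE. le_EE w v \<and> w \<in> I" if J: "I \<in> J_notnot" and v: "v \<in> LL" for v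
  proof -
    obtain h where "h \<in> EE" "v \<circ> h \<in> I"
      using J v by (auto simp: J_notnot_def LL_def)
    then show ?thesis
      using assms by (auto simp: le_EE_def ideal_EE_def)
  qed
  then show ?thesis
    using extended_enumerate_Ext[OF assms] J_notnot_extended J_notnot_if_extended[OF assms]
    by blast
qed

end
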